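(* Consider a PEPA model with two component types $X$ (local derivatives $X_1,\dots,X_m$) and $Y$ (local derivatives $Y_1,\dots,Y_n$) and one synchronisation, associated with $X_1$ and $Y_1$, so that its derived ODEs for $Z=(x_1,\dots,x_m,y_1,\dots,y_n)^T$ take the form $$\frac{\mathrm{d}Z}{\mathrm{d}t}=I_{\{rx_1\le sy_1\}}Q_1Z+I_{\{rx_1>sy_1\}}Q_2Z,$$ where $Q_1$ (resp. $Q_2$) is the coefficient matrix of the linear system obtained from the derived ODEs by replacing every occurrence of $\min\{rx_1,sy_1\}$ by $rx_1$ (resp. by $sy_1$). Then every eigenvalue of $Q_1$ and of $Q_2$ is either zero or has negative real part.
   Context: Setting: the PEPA model has positive real rates and no self-loops (no local derivative is both pre and post of the same labelled activity). All its action types are individual except one shared action type $\alpha$, enabled exactly by $X_1$ and $Y_1$. Individual transitions $P\xrightarrow{(\beta,r^{P\to Q}_\beta)}Q$ contribute rate functions $f(\mathbf{x},\beta^{P\to Q})=\mathbf{x}[P]r^{P\to Q}_\beta$; for the shared action with $r=r_\alpha(X_1)=\sum_Q r_\alpha^{X_1\to Q}$ and $s=r_\alpha(Y_1)=\sum_Q r_\alpha^{Y_1\to Q}$, each labelled activity $\alpha^{(X_1\to Q_1,Y_1\to Q_2)}$ has rate function $\frac{r_\alpha^{X_1\to Q_1}}{r}\frac{r_\alpha^{Y_1\to Q_2}}{s}\min\{rx_1,sy_1\}$. The derived ODEs are $\frac{\mathrm{d}\mathbf{x}}{\mathrm{d}t}=\sum_l l f(\mathbf{x},l)$, $l$ ranging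 over labelled activities identified with their transition vectors ($-1$ on pre set, $+1$ on post set, $0$ elsewhere); $x_i,y_j$ denote the amounts in $X_i,Y_j$. *)

theory Defs
  imports Complex_Main "Jordan_Normal_Form.Char_Poly"
begin

text \<open>Local derivatives \<open>X\<^sub>i\<close> and \<open>Y\<^sub>j\<close>, numbered from 1.\<close>

datatype local_deriv = XD nat | YD nat

text \<open>
  \<open>trans\<close> holds the triples \<open>(P, \<beta>, Q)\<close> for which \<open>P\<close> has a \<open>\<beta>\<close>-transition to \<open>Q\<close>;
  the rate \<open>r\<^sub>\<beta>\<close> of \<open>P \<rightarrow> Q\<close> is \<open>rate \<beta> P Q\<close>, which is irrelevant outside \<open>trans\<close>.
\<close>

record 'a pepa_model =
  numX :: nat
  numY :: nat
  shared :: 'a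
  trans :: "(local_deriv \<times> 'a \<times> local_deriv) set"
  rate :: "'a \<Rightarrow> local_deriv \<Rightarrow> local_deriv \<Rightarrow> real"

definition derivsX :: "'a pepa_model \<Rightarrow> local_deriv set" where
  "derivsX M = XD ` {1..numX M}"

definition derivsY :: "'a pepa_model \<Rightarrow> local_deriv set" where
  "derivsY M = YD ` {1..numY M}"

definition enabled :: "'a pepa_model \<Rightarrow> 'a \<Rightarrow> local_deriv \<Rightarrow> bool" where
  "enabled M \<beta> P \<longleftrightarrow> (\<exists>Q. (P, \<beta>, Q) \<in> trans M)"

definition derivatives :: "'a pepa_model \<Rightarrow> 'a \<Rightarrow> local_deriv \<Rightarrow> local_deriv set" where
  "derivatives M \<beta> P = {Q. (P, \<beta>, Q) \<in> trans M}"

definition apparent_rate :: "'a pepa_model \<Rightarrow> 'a \<Rightarrow> local_deriv \<Rightarrow> real" where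
  "apparent_rate M \<beta> P = (\<Sum>Q\<in>derivatives M \<beta> P. rate M \<beta> P Q)"

text \<open>
  \<open>Individual \<beta> P Q\<close> is the labelled activity \<open>\<beta>\<close> with label \<open>P \<rightarrow> Q\<close>; \<open>Shared Q1 Q2\<close> is the
  labelled activity of the shared action with label \<open>(X\<^sub>1 \<rightarrow> Q1, Y\<^sub>1 \<rightarrow> Q2)\<close>.
\<close>

datatype 'a activity =
    Individual 'a local_deriv local_deriv
  | Shared local_deriv local_deriv

fun pre_set :: "'a activity \<Rightarrow> local_deriv set" where
  "pre_set (Individual \<beta> P Q) = {P}"
| "pre_set (Shared Q1 Q2) = {XD 1, YD 1}"

fun post_set :: "'a activity \<Rightarrow> local_deriv set" where
  "post_set (Individual \<beta> P Q) = {Q}"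
| "post_set (Shared Q1 Q2) = {Q1, Q2}"

definition activities :: "'a pepa_model \<Rightarrow> 'a activity set" where
  "activities M =
     {Individual \<beta> P Q | \<beta> P Q. (P, \<beta>, Q) \<in> trans M \<and> \<beta> \<noteq> shared M} \<union>
     {Shared Q1 Q2 | Q1 Q2. Q1 \<in> derivatives M (shared M) (XD 1) \<and>
                            Q2 \<in> derivatives M (shared M) (YD 1)}"

definition two_component_pepa :: "'a pepa_model \<Rightarrow> bool" where
  "two_component_pepa M \<longleftrightarrow>
     finite (trans M) \<and>
     (\<forall>P \<beta> Q. (P, \<beta>, Q) \<in> trans M \<longrightarrow>
        (P \<in> derivsX M \<and> Q \<in> derivsX M) \<or> (P \<in> derivsY M \<and> Q \<in> derivsY M)) \<and>
     (\<forall>P \<beta> Q. (P, \<beta>, Q) \<in> trans M \<longrightarrow> rate M \<beta> P Q > 0) \<and>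
     {P. enabled M (shared M) P} = {XD 1, YD 1} \<and>
     (\<forall>l\<in>activities M. pre_set l \<inter> post_set l = {})"

text \<open>States are vectors \<open>Z = (x\<^sub>1, \<dots>, x\<^sub>m, y\<^sub>1, \<dots>, y\<^sub>n)\<close>; vector indices start at 0.\<close>

definition dim_state :: "'a pepa_model \<Rightarrow> nat" where
  "dim_state M = numX M + numY M"

fun pos :: "'a pepa_model \<Rightarrow> local_deriv \<Rightarrow> nat" where
  "pos M (XD i) = i - 1"
| "pos M (YD j) = numX M + (j - 1)"

definition amount :: "'a pepa_model \<Rightarrow> real vec \<Rightarrow> local_deriv \<Rightarrow> real" where
  "amount M Z P = Z $ pos M P"

definition transition_vec :: "'a pepa_model \<Rightarrow> 'a activity \<Rightarrow> real vec" where
  "transition_vec M l = vec (dim_state M)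
     (\<lambda>i. if i \<in> pos M ` pre_set l then - 1
          else if i \<in> pos M ` post_set l then 1 else 0)"

definition levelX :: "'a pepa_model \<Rightarrow> real vec \<Rightarrow> real" where
  "levelX M Z = apparent_rate M (shared M) (XD 1) * amount M Z (XD 1)"

definition levelY :: "'a pepa_model \<Rightarrow> real vec \<Rightarrow> real" where
  "levelY M Z = apparent_rate M (shared M) (YD 1) * amount M Z (YD 1)"

definition min_level :: "'a pepa_model \<Rightarrow> real vec \<Rightarrow> real" where
  "min_level M Z = min (levelX M Z) (levelY M Z)"

text \<open>
  The rate functions, with the term \<open>min {r x\<^sub>1, s y\<^sub>1}\<close> abstracted to a parameter \<open>\<mu>\<close>:
  \<open>\<mu> = min_level M\<close> gives the rate functions of the model, \<open>\<mu> = levelX M\<close> and \<open>\<mu> = levelY M\<close>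
  replace the minimum by \<open>r x\<^sub>1\<close> and by \<open>s y\<^sub>1\<close>.
\<close>

fun rate_fun :: "'a pepa_model \<Rightarrow> (real vec \<Rightarrow> real) \<Rightarrow> real vec \<Rightarrow> 'a activity \<Rightarrow> real" where
  "rate_fun M \<mu> Z (Individual \<beta> P Q) = amount M Z P * rate M \<beta> P Q"
| "rate_fun M \<mu> Z (Shared Q1 Q2) =
     rate M (shared M) (XD 1) Q1 / apparent_rate M (shared M) (XD 1) *
     (rate M (shared M) (YD 1) Q2 / apparent_rate M (shared M) (YD 1)) * \<mu> Z"

definition ode_rhs :: "'a pepa_model \<Rightarrow> (real vec \<Rightarrow> real) \<Rightarrow> real vec \<Rightarrow> real vec" where
  "ode_rhs M \<mu> Z = vec (dim_state M)
     (\<lambda>i. \<Sum>l\<in>activities M. transition_vec M l $ i * rate_fun M \<mu> Z l)"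

definition derived_ode_rhs :: "'a pepa_model \<Rightarrow> real vec \<Rightarrow> real vec" where
  "derived_ode_rhs M = ode_rhs M (min_level M)"

definition coefficient_matrix :: "nat \<Rightarrow> (real vec \<Rightarrow> real vec) \<Rightarrow> real mat \<Rightarrow> bool" where
  "coefficient_matrix N F A \<longleftrightarrow>
     A \<in> carrier_mat N N \<and> (\<forall>Z\<in>carrier_vec N. F Z = A *\<^sub>v Z)"

definition is_Q1 :: "'a pepa_model \<Rightarrow> real mat \<Rightarrow> bool" where
  "is_Q1 M A \<longleftrightarrow> coefficient_matrix (dim_state M) (ode_rhs M (levelX M)) A"

definition is_Q2 :: "'a pepa_model \<Rightarrow> real mat \<Rightarrow> bool" where
  "is_Q2 M A \<longleftrightarrow> coefficient_matrix (dim_state M) (ode_rhs M (levelY M)) A"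

lemma pos_less:
  assumes "P \<in> derivsX M \<union> derivsY M"
  shows "pos M P < dim_state M"
  using assms by (auto simp: derivsX_def derivsY_def dim_state_def)

lemma shared_derivs:
  assumes "two_component_pepa M"
  shows "XD 1 \<in> derivsX M" "YD 1 \<in> derivsY M"
proof -
  have "enabled M (shared M) (XD 1)" "enabled M (shared M) (YD 1)"
    using assms unfolding two_component_pepa_def by blast+
  then show "XD 1 \<in> derivsX M" "YD 1 \<in> derivsY M"
    using assms unfolding two_component_pepa_def enabled_def derivsX_def derivsY_def by blast+
qed

text \<open>The linear systems have exactly one coefficient matrix each.\<close>

lemma coefficient_matrix_unique:
  assumes "coefficient_matrix N F A" "coefficient_matrix N F B"
  shows "A = B"
proof (rule eq_matI)
  fix i j assume ij: "i < dim_row B" "j < dim_col B"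
  then have ij': "i < N" "j < N" and AB: "A \<in> carrier_mat N N" "B \<in> carrier_mat N N"
    using assms by (auto simp: coefficient_matrix_def)
  have "A *\<^sub>v unit_vec N j = B *\<^sub>v unit_vec N j"
    using assms by (metis coefficient_matrix_def unit_vec_carrier)
  then have "(A *\<^sub>v unit_vec N j) $ i = (B *\<^sub>v unit_vec N j) $ i" by simp
  then show "A $$ (i, j) = B $$ (i, j)" using ij' AB by simp
qed (use assms in \<open>auto simp: coefficient_matrix_def\<close>)

lemma ode_rhs_linear:
  assumes M: "two_component_pepa M"
    and k: "k < dim_state M" and \<mu>: "\<And>Z. \<mu> Z = c * Z $ k"
  shows "\<exists>A. coefficient_matrix (dim_state M) (ode_rhs M \<mu>) A"
proof -
  let ?N = "dim_state M"
  let ?A = "mat ?N ?N (\<lambda>(i, j). ode_rhs M \<mu> (unit_vec ?N j) $ i)"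
  have rf: "rate_fun M \<mu> Z l = (\<Sum>j<?N. rate_fun M \<mu> (unit_vec ?N j) l * Z $ j)"
    if l: "l \<in> activities M" for Z l
  proof (cases l)
    case (Individual \<beta> P Q)
    then have "pos M P < ?N"
      using M l pos_less[of P M] unfolding two_component_pepa_def activities_def by blast
    then have "(\<Sum>j<?N. rate_fun M \<mu> (unit_vec ?N j) l * Z $ j)
        = (\<Sum>j<?N. if j = pos M P then rate M \<beta> P Q * Z $ j else 0)"
      by (intro sum.cong) (auto simp: Individual amount_def)
    then show ?thesis
      using \<open>pos M P < ?N\<close> by (simp add: Individual amount_def)
  next
    case (Shared Q1 Q2)
    let ?q = "rate M (shared M) (XD 1) Q1 / apparent_rate M (shared M) (XD 1) *
      (rate M (shared M) (YD 1) Q2 / apparent_rate M (shared M) (YD 1))"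
    have "(\<Sum>j<?N. rate_fun M \<mu> (unit_vec ?N j) l * Z $ j)
        = (\<Sum>j<?N. if j = k then ?q * c * Z $ j else 0)"
      using k by (intro sum.cong) (auto simp: Shared \<mu>)
    then show ?thesis using k by (simp add: Shared \<mu>)
  qed
  have "ode_rhs M \<mu> Z = ?A *\<^sub>v Z" if Z: "Z \<in> carrier_vec ?N" for Z
  proof (rule eq_vecI)
    fix i assume "i < dim_vec (?A *\<^sub>v Z)"
    then have i: "i < ?N" by simp
    have "ode_rhs M \<mu> Z $ i = (\<Sum>l\<in>activities M. transition_vec M l $ i *
        (\<Sum>j<?N. rate_fun M \<mu> (unit_vec ?N j) l * Z $ j))"
      unfolding ode_rhs_def index_vec[OF i]
      by (intro sum.cong refl arg_cong2[where f = "(*)"] rf)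
    also have "\<dots> = (\<Sum>l\<in>activities M. \<Sum>j<?N.
        transition_vec M l $ i * rate_fun M \<mu> (unit_vec ?N j) l * Z $ j)"
      by (simp only: sum_distrib_left mult.assoc)
    also have "\<dots> = (\<Sum>j<?N. \<Sum>l\<in>activities M.
        transition_vec M l $ i * rate_fun M \<mu> (unit_vec ?N j) l * Z $ j)"
      by (rule sum.swap)
    also have "\<dots> = (\<Sum>j<?N. ode_rhs M \<mu> (unit_vec ?N j) $ i * Z $ j)"
      using i unfolding ode_rhs_def by (simp add: sum_distrib_right)
    also have "\<dots> = (?A *\<^sub>v Z) $ i"
      using i Z by (simp add: scalar_prod_def atLeast0LessThan)
    finally show "ode_rhs M \<mu> Z $ i = (?A *\<^sub>v Z) $ i" .
  qed (simp add: ode_rhs_def)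
  then show ?thesis unfolding coefficient_matrix_def
    by (intro exI[of _ ?A] conjI ballI mat_carrier)
qed

lemma is_Q1_ex1:
  assumes "two_component_pepa M"
  shows "\<exists>!A. is_Q1 M A"
proof -
  have "\<exists>A. is_Q1 M A"
    unfolding is_Q1_def
    by (rule ode_rhs_linear[where k = "pos M (XD 1)"
          and c = "apparent_rate M (shared M) (XD 1)"])
       (use assms shared_derivs[OF assms] pos_less[of "XD 1" M]
        in \<open>simp_all add: levelX_def amount_def del: pos.simps\<close>)
  then show ?thesis using coefficient_matrix_unique unfolding is_Q1_def by blast
qed

lemma is_Q2_ex1:
  assumes "two_component_pepa M"
  shows "\<exists>!A. is_Q2 M A"
proof -
  have "\<exists>A. is_Q2 M A"
    unfolding is_Q2_def
    by (rule ode_rhs_linear[where k = "pos M (YD 1)"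
          and c = "apparent_rate M (shared M) (YD 1)"])
       (use assms shared_derivs[OF assms] pos_less[of "YD 1" M]
        in \<open>simp_all add: levelY_def amount_def del: pos.simps\<close>)
  then show ?thesis using coefficient_matrix_unique unfolding is_Q2_def by blast
qed

text \<open>The derived ODEs have the piecewise linear form with coefficient matrices Q1 and Q2.\<close>

lemma derived_ode_rhs_switched:
  assumes "is_Q1 M Q1" "is_Q2 M Q2" "Z \<in> carrier_vec (dim_state M)"
  shows "derived_ode_rhs M Z =
    of_bool (levelX M Z \<le> levelY M Z) \<cdot>\<^sub>v (Q1 *\<^sub>v Z) +
    of_bool (levelX M Z > levelY M Z) \<cdot>\<^sub>v (Q2 *\<^sub>v Z)"
proof -
  have cong: "ode_rhs M \<mu> Z = ode_rhs M \<nu> Z" if "\<mu> Z = \<nu> Z" for \<mu> \<nu>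
  proof -
    have "rate_fun M \<mu> Z l = rate_fun M \<nu> Z l" for l using that by (cases l) auto
    then show ?thesis unfolding ode_rhs_def by simp
  qed
  have Q: "Q1 \<in> carrier_mat (dim_state M) (dim_state M)"
      "Q2 \<in> carrier_mat (dim_state M) (dim_state M)"
      "ode_rhs M (levelX M) Z = Q1 *\<^sub>v Z" "ode_rhs M (levelY M) Z = Q2 *\<^sub>v Z"
    using assms unfolding is_Q1_def is_Q2_def coefficient_matrix_def by auto
  show ?thesis
  proof (cases "levelX M Z \<le> levelY M Z")
    case True
    then have "derived_ode_rhs M Z = Q1 *\<^sub>v Z"
      unfolding derived_ode_rhs_def using cong[of "min_level M" "levelX M"] Q
      by (simp add: min_level_def)
    then show ?thesis using True Q by (intro eq_vecI) auto
  next
    case False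
    then have "derived_ode_rhs M Z = Q2 *\<^sub>v Z"
      unfolding derived_ode_rhs_def using cong[of "min_level M" "levelY M"] Q
      by (simp add: min_level_def)
    then show ?thesis using False Q by (intro eq_vecI) auto
  qed
qed

end

theory Submission
  imports Defs
begin

text \<open>
  Every activity either leaves the population of a component unchanged or moves one unit inside it,
  so the block of the coefficient matrix belonging to one component has nonnegative off-diagonal
  entries and vanishing column sums; Gershgorin's column discs then give the claim for that block.
  Replacing the minimum by \<open>r x\<^sub>1\<close> makes the \<open>X\<close>-part of the system independent of the
  \<open>Y\<close>-part, and replacing it by \<open>s y\<^sub>1\<close> does the converse. Hence an eigenvector restricts to an
  eigenvector of the independent block or, if it vanishes there, of the other block.
\<close>

section \<open>Eigenvalues of matrices with vanishing column sums\<close>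

text \<open>The closed disc with centre \<open>a\<close> and radius \<open>- a\<close> lies in the
  left half-plane and touches the imaginary axis only at 0.\<close>

lemma cmod_diff_nonpos_gt:
  assumes "a \<le> (0::real)" "k \<noteq> 0" "0 \<le> Re k"
  shows "- a < cmod (k - of_real a)"
proof -
  have "(- a)\<^sup>2 < a\<^sup>2 + (cmod k)\<^sup>2" using assms by simp
  also have "\<dots> \<le> (cmod (k - of_real a))\<^sup>2"
    using mult_nonpos_nonneg[OF assms(1,3)]
    unfolding cmod_power2 by (simp add: power2_eq_square algebra_simps)
  finally show ?thesis by (rule power2_less_imp_less) simp
qed

text \<open>The eigenvector equation bounds rows, while the hypotheses control columns. Instead of
  transposing, the row estimates are summed over all \<open>i\<close> and the double sum is swapped:
  column \<open>j\<close> then contributes its off-diagonal sum \<open>- a j j\<close> times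
  \<open>cmod (v j)\<close>, which contradicts the strict distance bound.\<close>

lemma zero_column_sum_eigenvalue:
  fixes a :: "'i \<Rightarrow> 'i \<Rightarrow> real" and v :: "'i \<Rightarrow> complex"
  assumes fin: "finite S"
    and off: "\<And>i j. i \<in> S \<Longrightarrow> j \<in> S \<Longrightarrow> i \<noteq> j \<Longrightarrow> 0 \<le> a i j"
    and col: "\<And>j. j \<in> S \<Longrightarrow> (\<Sum>i\<in>S. a i j) = 0"
    and eig: "\<And>i. i \<in> S \<Longrightarrow> (\<Sum>j\<in>S. of_real (a i j) * v j) = k * v i"
    and nz: "i0 \<in> S" "v i0 \<noteq> 0"
  shows "k = 0 \<or> Re k < 0"
proof (rule ccontr)
  assume "\<not> ?thesis"
  then have k: "k \<noteq> 0" "0 \<le> Re k" by auto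
  have diag: "(\<Sum>i\<in>S - {j}. a i j) = - a j j" if "j \<in> S" for j
    using col[OF that] fin that by (simp add: sum.remove)
  then have neg: "a j j \<le> 0" if "j \<in> S" for j
    using sum_nonneg[of "S - {j}" "\<lambda>i. a i j"] off that by fastforce
  have row: "cmod (k - of_real (a i i)) * cmod (v i) \<le> (\<Sum>j\<in>S - {i}. a i j * cmod (v j))"
    if i: "i \<in> S" for i
  proof -
    have "(k - of_real (a i i)) * v i = (\<Sum>j\<in>S - {i}. of_real (a i j) * v j)"
      using eig[OF i] fin i by (simp add: sum.remove algebra_simps)
    then have "cmod (k - of_real (a i i)) * cmod (v i) = cmod (\<Sum>j\<in>S - {i}. of_real (a i j) * v j)"
      by (metis norm_mult)
    also have "\<dots> \<le> (\<Sum>j\<in>S - {i}. cmod (of_real (a i j) * v j))" by (rule norm_sum)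
    also have "\<dots> = (\<Sum>j\<in>S - {i}. a i j * cmod (v j))"
      by (rule sum.cong) (use off i in \<open>auto simp: norm_mult\<close>)
    finally show ?thesis .
  qed
  \<comment> \<open>Strictness can come only from indices with \<open>v i \<noteq> 0\<close>, and
    \<open>i0\<close> is one.\<close>
  have "(\<Sum>i\<in>S. - a i i * cmod (v i)) < (\<Sum>i\<in>S. cmod (k - of_real (a i i)) * cmod (v i))"
  proof (rule sum_strict_mono_ex1[OF fin])
    show "\<forall>i\<in>S. - a i i * cmod (v i) \<le> cmod (k - of_real (a i i)) * cmod (v i)"
      using cmod_diff_nonpos_gt[OF neg k] by (fastforce intro: mult_right_mono)
    show "\<exists>i\<in>S. - a i i * cmod (v i) < cmod (k - of_real (a i i)) * cmod (v i)"
      using cmod_diff_nonpos_gt[OF neg k] nz by (intro bexI[of _ i0] mult_strict_right_mono) auto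
  qed
  also have "\<dots> \<le> (\<Sum>i\<in>S. \<Sum>j\<in>S - {i}. a i j * cmod (v j))"
    by (rule sum_mono) (rule row)
  \<comment> \<open>The inner range depends on \<open>i\<close>; padding with zeros makes it
    rectangular, so the sums can be swapped.\<close>
  also have "\<dots> = (\<Sum>i\<in>S. \<Sum>j\<in>S. if i = j then 0 else a i j * cmod (v j))"
    by (intro sum.cong refl sum.mono_neutral_cong_left) (use fin in auto)
  also have "\<dots> = (\<Sum>j\<in>S. \<Sum>i\<in>S. if i = j then 0 else a i j * cmod (v j))"
    by (rule sum.swap)
  also have "\<dots> = (\<Sum>j\<in>S. \<Sum>i\<in>S - {j}. a i j * cmod (v j))"
    by (intro sum.cong refl sum.mono_neutral_cong_right) (use fin in auto)
  also have "\<dots> = (\<Sum>j\<in>S. - a j j * cmod (v j))"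
    by (simp add: diag flip: sum_distrib_right)
  finally show False by simp
qed

text \<open>The block with rows in \<open>T\<close> and columns in \<open>S\<close> is left free:
  there the shared action produces a negative entry, so the whole matrix need not have nonnegative
  off-diagonal entries.\<close>

lemma block_triangular_eigenvalue:
  fixes a :: "'i \<Rightarrow> 'i \<Rightarrow> real" and v :: "'i \<Rightarrow> complex"
  assumes fin: "finite S" "finite T" and disj: "S \<inter> T = {}"
    and off: "\<And>U i j. U \<in> {S, T} \<Longrightarrow> i \<in> U \<Longrightarrow> j \<in> U \<Longrightarrow> i \<noteq> j \<Longrightarrow> 0 \<le> a i j"
    and col: "\<And>U j. U \<in> {S, T} \<Longrightarrow> j \<in> U \<Longrightarrow> (\<Sum>i\<in>U. a i j) = 0"
    and zero: "\<And>i j. i \<in> S \<Longrightarrow> j \<in> T \<Longrightarrow> a i j = 0"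
    and eig: "\<And>i. i \<in> S \<union> T \<Longrightarrow> (\<Sum>j\<in>S \<union> T. of_real (a i j) * v j) = k * v i"
    and nz: "i0 \<in> S \<union> T" "v i0 \<noteq> 0"
  shows "k = 0 \<or> Re k < 0"
proof (cases "\<exists>i\<in>S. v i \<noteq> 0")
  case True
  then obtain i where i: "i \<in> S" "v i \<noteq> 0" by blast
  show ?thesis
  proof (rule zero_column_sum_eigenvalue[where S = S and a = a and v = v, OF fin(1) _ _ _ i])
    fix i assume i: "i \<in> S"
    have "(\<Sum>j\<in>T. of_real (a i j) * v j) = 0"
      using zero i by (intro sum.neutral) simp
    then show "(\<Sum>j\<in>S. of_real (a i j) * v j) = k * v i"
      using eig[of i] i by (simp add: sum.union_disjoint[OF fin disj])
  qed (use off col in auto)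
next
  case False
  with nz have i0: "i0 \<in> T" by blast
  show ?thesis
  proof (rule zero_column_sum_eigenvalue[where S = T and a = a and v = v, OF fin(2) _ _ _ i0 nz(2)])
    fix i assume i: "i \<in> T"
    have "(\<Sum>j\<in>S. of_real (a i j) * v j) = 0"
      using False by (intro sum.neutral) simp
    then show "(\<Sum>j\<in>T. of_real (a i j) * v j) = k * v i"
      using eig[of i] i by (simp add: sum.union_disjoint[OF fin disj])
  qed (use off col in auto)
qed

section \<open>Local derivatives, activities and their transition vectors\<close>

lemma finite_derivs: "finite (derivsX M)" "finite (derivsY M)"
  by (simp_all add: derivsX_def derivsY_def)

lemma derivs_disjoint: "derivsX M \<inter> derivsY M = {}"
  by (auto simp: derivsX_def derivsY_def)

lemma bij_betw_pos: "bij_betw (pos M) (derivsX M \<union> derivsY M) {..<dim_state M}"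
proof (rule bij_betw_imageI)
  show "inj_on (pos M) (derivsX M \<union> derivsY M)"
    by (auto simp: inj_on_def derivsX_def derivsY_def)
  show "pos M ` (derivsX M \<union> derivsY M) = {..<dim_state M}"
  proof
    show "{..<dim_state M} \<subseteq> pos M ` (derivsX M \<union> derivsY M)"
    proof
      fix i assume i: "i \<in> {..<dim_state M}"
      show "i \<in> pos M ` (derivsX M \<union> derivsY M)"
      proof (cases "i < numX M")
        case True
        then have "XD (Suc i) \<in> derivsX M" by (simp add: derivsX_def)
        then show ?thesis by (metis UnI1 diff_Suc_1 image_eqI pos.simps(1))
      next
        case False
        then have "YD (Suc (i - numX M)) \<in> derivsY M" "pos M (YD (Suc (i - numX M))) = i"
          using i by (auto simp: derivsY_def dim_state_def)
        then show ?thesis by (metis UnI2 image_eqI)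
      qed
    qed
  qed (use pos_less in blast)
qed

lemma pos_eq_iff:
  assumes "P \<in> derivsX M \<union> derivsY M" "R \<in> derivsX M \<union> derivsY M"
  shows "pos M P = pos M R \<longleftrightarrow> P = R"
  using bij_betw_imp_inj_on[OF bij_betw_pos] assms by (rule inj_on_eq_iff)

text \<open>The last claim is conservation within a component. It holds because transitions never
  cross components and the shared action takes exactly one participant from each. The singleton form
  also yields that a component contains at most one element of a pre set.\<close>

lemma activity_sets:
  assumes M: "two_component_pepa M" and l: "l \<in> activities M"
  shows "pre_set l \<subseteq> derivsX M \<union> derivsY M" "post_set l \<subseteq> derivsX M \<union> derivsY M"
    and "pre_set l \<inter> post_set l = {}"
    and "C \<in> {derivsX M, derivsY M} \<Longrightarrow>
      pre_set l \<inter> C = {} \<and> post_set l \<inter> C = {} \<or>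
      (\<exists>P Q. pre_set l \<inter> C = {P} \<and> post_set l \<inter> C = {Q})"
proof -
  have tr: "P \<in> derivsX M \<and> Q \<in> derivsX M \<and> P \<notin> derivsY M \<and> Q \<notin> derivsY M \<or>
      P \<in> derivsY M \<and> Q \<in> derivsY M \<and> P \<notin> derivsX M \<and> Q \<notin> derivsX M"
    if "(P, \<beta>, Q) \<in> trans M" for P \<beta> Q
    using M that derivs_disjoint[of M] unfolding two_component_pepa_def by blast
  show "pre_set l \<inter> post_set l = {}"
    using M l unfolding two_component_pepa_def by blast
  have "pre_set l \<subseteq> derivsX M \<union> derivsY M \<and> post_set l \<subseteq> derivsX M \<union> derivsY M \<and>
     (C \<in> {derivsX M, derivsY M} \<longrightarrow> pre_set l \<inter> C = {} \<and> post_set l \<inter> C = {} \<or>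
      (\<exists>P Q. pre_set l \<inter> C = {P} \<and> post_set l \<inter> C = {Q}))"
  proof (cases l)
    case (Individual \<beta> P Q)
    then have "(P, \<beta>, Q) \<in> trans M" using l by (auto simp: activities_def)
    from tr[OF this] show ?thesis unfolding Individual by auto
  next
    case (Shared R S)
    then have "(XD 1, shared M, R) \<in> trans M" "(YD 1, shared M, S) \<in> trans M"
      using l by (auto simp: activities_def derivatives_def)
    note trs = this[THEN tr]
    have "XD 1 \<in> derivsX M" "YD 1 \<in> derivsY M" using shared_derivs[OF M] by auto
    with trs derivs_disjoint[of M] have mem:
      "R \<in> derivsX M" "R \<notin> derivsY M" "S \<in> derivsY M" "S \<notin> derivsX M"
      "XD 1 \<in> derivsX M" "XD 1 \<notin> derivsY M" "YD 1 \<in> derivsY M" "YD 1 \<notin> derivsX M"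
      by blast+
    then have "pre_set l \<inter> derivsX M = {XD 1}" "post_set l \<inter> derivsX M = {R}"
      "pre_set l \<inter> derivsY M = {YD 1}" "post_set l \<inter> derivsY M = {S}"
      unfolding Shared by auto
    then show ?thesis using mem unfolding Shared by auto
  qed
  note sets = this
  show "pre_set l \<subseteq> derivsX M \<union> derivsY M" "post_set l \<subseteq> derivsX M \<union> derivsY M"
    using sets by simp_all
  show "pre_set l \<inter> C = {} \<and> post_set l \<inter> C = {} \<or>
      (\<exists>P Q. pre_set l \<inter> C = {P} \<and> post_set l \<inter> C = {Q})"
    if "C \<in> {derivsX M, derivsY M}"
    using sets[THEN conjunct2, THEN conjunct2, THEN mp, OF that] .
qed

lemma transition_vec_pos:
  assumes M: "two_component_pepa M" and l: "l \<in> activities M"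
    and P: "P \<in> derivsX M \<union> derivsY M"
  shows "transition_vec M l $ pos M P =
    (if P \<in> pre_set l then - 1 else if P \<in> post_set l then 1 else 0)"
proof -
  have "pos M P \<in> pos M ` A \<longleftrightarrow> P \<in> A" if "A \<subseteq> derivsX M \<union> derivsY M" for A
    using inj_on_image_mem_iff[OF bij_betw_imp_inj_on[OF bij_betw_pos] P that] .
  with activity_sets(1,2)[OF M l] pos_less[OF P] show ?thesis
    by (simp add: transition_vec_def)
qed

lemma sum_transition_vec:
  assumes M: "two_component_pepa M" and l: "l \<in> activities M"
    and C: "C \<in> {derivsX M, derivsY M}"
  shows "(\<Sum>P\<in>C. transition_vec M l $ pos M P) = 0"
proof -
  have fin: "finite C" using C finite_derivs by auto
  \<comment> \<open>\<open>transition_vec\<close> tests the pre set first; disjointness of pre and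
    post set turns this into a difference of indicators.\<close>
  have "(\<Sum>P\<in>C. transition_vec M l $ pos M P) =
      (\<Sum>P\<in>C. of_bool (P \<in> post_set l) - of_bool (P \<in> pre_set l))"
    using C activity_sets(3)[OF M l]
    by (intro sum.cong refl) (subst transition_vec_pos[OF M l], auto)
  also have "\<dots> = real (card (post_set l \<inter> C)) - real (card (pre_set l \<inter> C))"
    using fin by (simp add: sum_subtractf of_bool_def sum.If_cases Int_commute)
  also have "\<dots> = 0"
    using activity_sets(4)[OF M l C] by auto
  finally show ?thesis .
qed

lemma apparent_rate_nonneg:
  assumes "two_component_pepa M"
  shows "0 \<le> apparent_rate M \<beta> P"
  using assms unfolding apparent_rate_def two_component_pepa_def derivatives_def
  by (intro sum_nonneg) (auto intro: less_imp_le)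

text \<open>Amounts are constrained on the pre set only, because vector entries outside the
  dimension are unspecified.\<close>

lemma rate_fun_nonneg:
  assumes M: "two_component_pepa M" and l: "l \<in> activities M"
    and \<mu>: "0 \<le> \<mu> Z" and Z: "\<And>P. P \<in> pre_set l \<Longrightarrow> 0 \<le> amount M Z P"
  shows "0 \<le> rate_fun M \<mu> Z l"
proof (cases l)
  case (Individual \<beta> P Q)
  then have "0 < rate M \<beta> P Q"
    using M l unfolding two_component_pepa_def activities_def by blast
  then show ?thesis using Z by (simp add: Individual)
next
  case (Shared R S)
  then have "0 < rate M (shared M) (XD 1) R" "0 < rate M (shared M) (YD 1) S"
    using M l unfolding two_component_pepa_def activities_def derivatives_def by blast+
  then show ?thesis
    using \<mu> apparent_rate_nonneg[OF M]
    by (auto simp: Shared intro!: mult_nonneg_nonneg divide_nonneg_nonneg)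
qed

section \<open>Eigenvalues of the coefficient matrices\<close>

text \<open>Treats both matrices at once: \<open>H\<close> is the local derivative whose level
  replaces the minimum, \<open>C\<close> its component, which evolves independently, and
  \<open>D\<close> the other component.\<close>

lemma ode_rhs_eigenvalue:
  fixes c :: real
  assumes M: "two_component_pepa M"
    and A: "coefficient_matrix (dim_state M) (ode_rhs M \<mu>) A"
    and H: "(H, C, D) = (XD 1, derivsX M, derivsY M) \<or> (H, C, D) = (YD 1, derivsY M, derivsX M)"
    and \<mu>: "\<And>Z. \<mu> Z = c * amount M Z H" and c: "0 \<le> c"
    and k: "eigenvalue (map_mat complex_of_real A) k"
  shows "k = 0 \<or> Re k < 0"
proof -
  \<comment> \<open>\<open>e R\<close> is the state with a single unit, in \<open>R\<close>. The
    right-hand side there is column \<open>R\<close> of the matrix, so the entries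
    \<open>a P R\<close> can be read off the activities that have nonzero rate in
    \<open>e R\<close>.\<close>
  let ?N = "dim_state M" and ?U = "derivsX M \<union> derivsY M"
  define e where "e R = (unit_vec ?N (pos M R) :: real vec)" for R
  define a where "a P R = A $$ (pos M P, pos M R)" for P R
  have CD: "C \<union> D = ?U" "C \<inter> D = {}" "finite C" "finite D" "{C, D} = {derivsX M, derivsY M}"
    "H \<in> C"
    using H derivs_disjoint[of M] finite_derivs[of M] shared_derivs[OF M] by auto
  have carr: "A \<in> carrier_mat ?N ?N" using A by (simp add: coefficient_matrix_def)
  have amount_e: "amount M (e R) P = of_bool (P = R)" if "P \<in> ?U" "R \<in> ?U" for P R
    using that pos_less[of P M] pos_less[of R M] pos_eq_iff[OF that]
    by (simp add: amount_def e_def)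
  have a: "a P R = (\<Sum>l\<in>activities M. transition_vec M l $ pos M P * rate_fun M \<mu> (e R) l)"
    if "P \<in> ?U" "R \<in> ?U" for P R
  proof -
    have "ode_rhs M \<mu> (e R) = A *\<^sub>v e R"
      using A by (simp add: coefficient_matrix_def e_def)
    then have "a P R = ode_rhs M \<mu> (e R) $ pos M P"
      using carr pos_less[OF that(1)] pos_less[OF that(2)] by (simp add: a_def e_def)
    then show ?thesis using pos_less[OF that(1)] by (simp add: ode_rhs_def)
  qed
  have HU: "H \<in> ?U" using CD(1,6) by blast
  have nonneg: "0 \<le> rate_fun M \<mu> (e R) l" if l: "l \<in> activities M" and R: "R \<in> ?U" for l R
  proof (rule rate_fun_nonneg[OF M l])
    show "0 \<le> \<mu> (e R)" unfolding \<mu> amount_e[OF HU R] using c by simp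
    show "0 \<le> amount M (e R) P" if "P \<in> pre_set l" for P
      using amount_e[OF subsetD[OF activity_sets(1)[OF M l] that] R] by simp
  qed
  \<comment> \<open>In \<open>e R\<close> an individual activity has nonzero rate only if it starts
    in \<open>R\<close>. A shared one needs only \<open>R = H\<close>, although its other
    participant then has amount 0; this is the one case where the pre set exceeds
    \<open>{R}\<close>.\<close>
  have source: "R \<in> pre_set l \<and> (pre_set l \<subseteq> {R} \<or> R = H)"
    if l: "l \<in> activities M" and R: "R \<in> ?U" and nz: "rate_fun M \<mu> (e R) l \<noteq> 0" for l R
  proof (cases l)
    case (Individual \<beta> P Q)
    then have "P \<in> ?U" using activity_sets(1)[OF M l] by simp
    from amount_e[OF this R] show ?thesis using nz by (simp add: Individual split: if_splits)
  next
    case (Shared S T)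
    then have "R = H" using nz amount_e[OF HU R] by (simp add: \<mu> split: if_splits)
    then show ?thesis using H unfolding Shared by fastforce
  qed
  from k obtain v where v: "v \<in> carrier_vec ?N" "v \<noteq> 0\<^sub>v ?N"
      "map_mat complex_of_real A *\<^sub>v v = k \<cdot>\<^sub>v v"
    using carr unfolding eigenvalue_def eigenvector_def by auto
  have "\<exists>i<?N. v $ i \<noteq> 0"
  proof (rule ccontr)
    assume "\<not> ?thesis"
    then have "v = 0\<^sub>v ?N" using v(1) by (intro eq_vecI) auto
    with v(2) show False by simp
  qed
  then obtain P0 where P0: "P0 \<in> C \<union> D" "v $ pos M P0 \<noteq> 0"
    using bij_betw_imp_surj_on[OF bij_betw_pos[of M]] CD(1)
    by (metis imageE lessThan_iff)
  show ?thesis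
  proof (rule block_triangular_eigenvalue[where a = a and v = "\<lambda>P. v $ pos M P", OF CD(3,4,2)])
    fix U P R assume U: "U \<in> {C, D}" and P: "P \<in> U" and R: "R \<in> U" and ne: "P \<noteq> R"
    then have PR: "P \<in> ?U" "R \<in> ?U" using CD(1) by auto
    have "0 \<le> transition_vec M l $ pos M P * rate_fun M \<mu> (e R) l"
      if l: "l \<in> activities M" for l
    proof (cases "rate_fun M \<mu> (e R) l = 0")
      case False
      have UXY: "U \<in> {derivsX M, derivsY M}" using U CD(5) by blast
      \<comment> \<open>Even for a shared activity the second participant lies in the other
        component, so inside \<open>U\<close> only \<open>R\<close> can decrease.\<close>
      have "R \<in> pre_set l \<inter> U" using source[OF l PR(2) False] R by blast
      with activity_sets(4)[OF M l UXY] have "pre_set l \<inter> U = {R}"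
        by (metis empty_iff singletonD)
      then have "P \<notin> pre_set l" using P ne by blast
      then show ?thesis using nonneg[OF l PR(2)] transition_vec_pos[OF M l PR(1)] by simp
    qed simp
    then show "0 \<le> a P R" unfolding a[OF PR] by (rule sum_nonneg)
  next
    fix U R assume U: "U \<in> {C, D}" and R: "R \<in> U"
    then have UXY: "U \<in> {derivsX M, derivsY M}" and R': "R \<in> ?U" using CD(1,5) by blast+
    have "(\<Sum>P\<in>U. a P R) =
        (\<Sum>P\<in>U. \<Sum>l\<in>activities M. transition_vec M l $ pos M P * rate_fun M \<mu> (e R) l)"
      using UXY by (intro sum.cong refl a R') auto
    also have "\<dots> = (\<Sum>l\<in>activities M. (\<Sum>P\<in>U. transition_vec M l $ pos M P) * rate_fun M \<mu> (e R) l)"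
      by (subst sum.swap) (simp add: sum_distrib_right)
    also have "\<dots> = 0"
      using sum_transition_vec[OF M _ UXY] by (intro sum.neutral) simp
    finally show "(\<Sum>P\<in>U. a P R) = 0" .
  next
    fix P R assume P: "P \<in> C" and R: "R \<in> D"
    then have PR: "P \<in> ?U" "R \<in> ?U" using CD(1) by auto
    have "transition_vec M l $ pos M P * rate_fun M \<mu> (e R) l = 0"
      if l: "l \<in> activities M" for l
    proof (cases "rate_fun M \<mu> (e R) l = 0")
      case False
      \<comment> \<open>A column in \<open>D\<close> is not column \<open>H\<close>, so the activity
        takes only from \<open>R\<close> and, by conservation, leaves \<open>C\<close>
        untouched.\<close>
      have "R \<noteq> H" using R CD(2,6) by blast
      then have "pre_set l = {R}" using source[OF l PR(2) False] by blast
      then have pre: "pre_set l \<inter> C = {}" using R CD(2) by auto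
      have "C \<in> {derivsX M, derivsY M}" using H by auto
      from activity_sets(4)[OF M l this] pre have "post_set l \<inter> C = {}"
        by (metis insert_not_empty)
      with pre have "P \<notin> pre_set l" "P \<notin> post_set l" using P by auto
      then show ?thesis by (simp add: transition_vec_pos[OF M l PR(1)])
    qed simp
    then show "a P R = 0" unfolding a[OF PR] by (intro sum.neutral ballI)
  next
    fix P assume "P \<in> C \<union> D"
    then have P: "pos M P < ?N" using CD(1) pos_less by blast
    \<comment> \<open>Reindexing along \<open>pos\<close> turns the sum over local derivatives into
      an ordinary matrix-vector product.\<close>
    have "(\<Sum>R\<in>C \<union> D. complex_of_real (a P R) * v $ pos M R) =
        (\<Sum>j<?N. complex_of_real (A $$ (pos M P, j)) * v $ j)"
      unfolding a_def CD(1) by (rule sum.reindex_bij_betw[OF bij_betw_pos])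
    also have "\<dots> = (map_mat complex_of_real A *\<^sub>v v) $ pos M P"
      using carr v(1) P by (simp add: scalar_prod_def atLeast0LessThan)
    also have "\<dots> = k * v $ pos M P" using v(1,3) P by simp
    finally show "(\<Sum>R\<in>C \<union> D. complex_of_real (a P R) * v $ pos M R) = k * v $ pos M P" .
  qed (fact P0)+
qed

theorem theorem7:
  fixes M :: "'a pepa_model" and Q1 Q2 :: "real mat"
  assumes "two_component_pepa M"
    and "is_Q1 M Q1"
    and "is_Q2 M Q2"
  shows "(\<forall>k. eigenvalue (map_mat complex_of_real Q1) k \<longrightarrow> k = 0 \<or> Re k < 0) \<and>
         (\<forall>k. eigenvalue (map_mat complex_of_real Q2) k \<longrightarrow> k = 0 \<or> Re k < 0)"
  using ode_rhs_eigenvalue[OF assms(1) assms(2)[unfolded is_Q1_def],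
      where H = "XD 1" and C = "derivsX M" and D = "derivsY M" and
        c = "apparent_rate M (shared M) (XD 1)"]
    ode_rhs_eigenvalue[OF assms(1) assms(3)[unfolded is_Q2_def],
      where H = "YD 1" and C = "derivsY M" and D = "derivsX M" and
        c = "apparent_rate M (shared M) (YD 1)"]
    apparent_rate_nonneg[OF assms(1)]
  by (simp add: levelX_def levelY_def)

end
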